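(* Let $a_k$ denote the number of nonempty $\otimes$-irreducible partition diagrams in $A_k$, for $k \geq 1$, and let $B_m$ be the $m$-th Bell number. Then, as formal power series, $$\sum_{k=1}^{\infty} a_k x^k = 1 - \frac{1}{1 + \sum_{k=1}^{\infty} B_{2k} x^k}.$$
   Context: For $k \geq 0$, a partition diagram of order $k$ is a set partition of $\{1,\ldots,k,1',\ldots,k'\}$; $A_k$ denotes the set of such diagrams. For $\pi \in A_k$ and $\rho \in A_l$, $\pi \otimes \rho \in A_{k+l}$ is the set partition whose blocks are the blocks of $\pi$ together with the blocks of $\rho$ with every $i$ replaced by $i+k$ and every $i'$ by $(i+k)'$. A diagram is $\otimes$-irreducible if it cannot be written as $\rho^{(1)} \otimes \rho^{(2)}$ with $\rho^{(1)},\rho^{(2)}$ nonempty (of positive order). *)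

theory Defs
  imports Complex_Main "HOL-Library.Disjoint_Sets" "HOL-Computational_Algebra.Formal_Power_Series"
begin

(* The unprimed vertex i is encoded as Inl i, the primed vertex i' as Inr i. *)
definition vertices :: "nat \<Rightarrow> (nat + nat) set" where
  "vertices k = {1..k} <+> {1..k}"

definition diagrams :: "nat \<Rightarrow> (nat + nat) set set set" where
  "diagrams k = {\<pi>. partition_on (vertices k) \<pi>}"

definition shift :: "nat \<Rightarrow> nat + nat \<Rightarrow> nat + nat" where
  "shift k = map_sum (\<lambda>i. i + k) (\<lambda>i. i + k)"

(* The order k of the left factor is passed explicitly. *)
definition tensor :: "nat \<Rightarrow> (nat + nat) set set \<Rightarrow> (nat + nat) set set \<Rightarrow> (nat + nat) set set" where
  "tensor k \<pi> \<rho> = \<pi> \<union> (\<lambda>B. shift k ` B) ` \<rho>"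

lemma partition_on_Un:
  assumes "partition_on A P" "partition_on B Q" "A \<inter> B = {}"
  shows "partition_on (A \<union> B) (P \<union> Q)"
proof (rule partition_onI)
  show "\<Union>(P \<union> Q) = A \<union> B"
    using assms by (simp add: partition_on_def)
  show "{} \<notin> P \<union> Q"
    using assms by (simp add: partition_on_def)
  have sub: "p \<subseteq> A" if "p \<in> P" for p using that assms(1) by (auto simp: partition_on_def)
  have sub': "q \<subseteq> B" if "q \<in> Q" for q using that assms(2) by (auto simp: partition_on_def)
  have dP: "pairwise disjnt P" and dQ: "pairwise disjnt Q"
    using assms by (auto simp: partition_on_def)
  fix p q assume pq: "p \<in> P \<union> Q" "q \<in> P \<union> Q" "p \<noteq> q"
  then consider "p \<in> P" "q \<in> P" | "p \<in> Q" "q \<in> Q" | "p \<in> P" "q \<in> Q" | "p \<in> Q" "q \<in> P"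
    by blast
  then show "disjnt p q"
  proof cases
    case 1 then show ?thesis using dP pq(3) by (simp add: pairwise_def)
  next
    case 2 then show ?thesis using dQ pq(3) by (simp add: pairwise_def)
  next
    case 3 then show ?thesis using sub[of p] sub'[of q] assms(3) unfolding disjnt_def by blast
  next
    case 4 then show ?thesis using sub[of q] sub'[of p] assms(3) unfolding disjnt_def by blast
  qed
qed

lemma tensor_in_diagrams:
  assumes "\<pi> \<in> diagrams k" and "\<rho> \<in> diagrams l"
  shows "tensor k \<pi> \<rho> \<in> diagrams (k + l)"
proof -
  have inj: "inj_on (shift k) (vertices l)"
    unfolding shift_def by (auto simp: inj_on_def vertices_def)
  have p: "partition_on (vertices k) \<pi>" "partition_on (vertices l) \<rho>"
    using assms by (auto simp: diagrams_def)
  have "{} \<notin> (`) (shift k) ` \<rho>"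
    using partition_onD3[OF p(2)] by auto
  then have q: "partition_on (shift k ` vertices l) ((`) (shift k) ` \<rho>)"
    using partition_on_inj_image[OF p(2) inj] by simp
  have img: "(\<lambda>i. i + k) ` {1..l} = {k+1..k+l}"
    by (simp add: add.commute)
  have s: "shift k ` vertices l = {k+1..k+l} <+> {k+1..k+l}"
    unfolding img[symmetric] shift_def vertices_def Plus_def by (simp only: image_Un image_image map_sum.simps)
  have un: "vertices (k + l) = vertices k \<union> shift k ` vertices l"
    unfolding s by (auto simp: vertices_def)
  have "vertices k \<inter> shift k ` vertices l = {}"
    unfolding s by (auto simp: vertices_def)
  from partition_on_Un[OF p(1) q this] show ?thesis
    by (simp add: diagrams_def tensor_def un)
qed

(* By tensor_in_diagrams, a diagram of order k can equal such a product only if i + j = k. *)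
definition tensor_irreducible :: "(nat + nat) set set \<Rightarrow> bool" where
  "tensor_irreducible \<pi> \<longleftrightarrow>
     \<not> (\<exists>i j. \<exists>\<rho>1 \<in> diagrams i. \<exists>\<rho>2 \<in> diagrams j. i > 0 \<and> j > 0 \<and> \<pi> = tensor i \<rho>1 \<rho>2)"

definition num_irreducible :: "nat \<Rightarrow> nat" where
  "num_irreducible k = card {\<pi> \<in> diagrams k. tensor_irreducible \<pi>}"

definition Bell :: "nat \<Rightarrow> nat" where
  "Bell m = card {P. partition_on {1..m} P}"

end

theory Submission
  imports Defs
begin

text \<open>Call \<open>\<rho>\<close> a left factor of a diagram \<open>\<pi>\<close> if \<open>\<pi> = \<rho> \<otimes> \<sigma>\<close> for some \<open>\<sigma>\<close>; this happens exactly
  if \<open>\<rho> \<subseteq> \<pi>\<close> as sets of blocks. The left factors of \<open>\<pi>\<close> therefore form a chain, so every \<open>\<pi>\<close> of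
  positive order has exactly one irreducible left factor (the smallest nonempty one), and \<open>\<sigma>\<close> is
  determined by it. Hence \<open>F = 1 + I F\<close>, where \<open>F\<close> and \<open>I\<close> are the generating functions of all
  diagrams and of the irreducible ones.\<close>

section \<open>Partitions of arbitrary sets\<close>

text \<open>Used to strip a left factor from a diagram. Every point of \<open>A\<close> already lies
  in a block of \<open>P\<close>, which is also a block of \<open>Q\<close>, so by disjointness the
  other blocks of \<open>Q\<close> avoid \<open>A\<close>.\<close>

lemma partition_on_Diff:
  assumes "partition_on A P" "partition_on B Q" "P \<subseteq> Q"
  shows "partition_on (B - A) (Q - P)"
proof (rule partition_onI)
  show "\<Union>(Q - P) = B - A"
  proof
    show "\<Union>(Q - P) \<subseteq> B - A"
      using assms by (fastforce simp: partition_on_def disjoint_def)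
    show "B - A \<subseteq> \<Union>(Q - P)"
      using assms by (auto simp: partition_on_def)
  qed
qed (use assms in \<open>auto simp: partition_on_def pairwise_def\<close>)

text \<open>Moves the count from the sum type of \<open>vertices\<close> to the interval in
  \<open>Bell\<close>: blocks are pushed forward along \<open>f\<close> and pulled back along
  \<open>inv_into A f\<close>.\<close>

lemma card_partition_on_image:
  assumes "inj_on f A"
  shows "card {P. partition_on (f ` A) P} = card {P. partition_on A P}"
proof -
  have "bij_betw ((`) ((`) f)) {P. partition_on A P} {P. partition_on (f ` A) P}"
    unfolding bij_betw_def
  proof
    have "inj_on ((`) ((`) f)) (Pow (Pow A))"
      by (intro inj_on_image_Pow assms)
    then show "inj_on ((`) ((`) f)) {P. partition_on A P}"
      by (rule inj_on_subset) (auto simp: partition_on_def)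
    \<comment> \<open>Stated for arbitrary \<open>h\<close>, since it is applied both to
      \<open>f\<close> and to its inverse.\<close>
    have image: "partition_on (h ` C) ((`) h ` P)" if "partition_on C P" "inj_on h C"
      for h :: "'c \<Rightarrow> 'd" and C P
    proof -
      have "{} \<notin> (`) h ` P"
        using partition_onD3[OF that(1)] by auto
      with partition_on_inj_image[OF that] show ?thesis by simp
    qed
    show "((`) ((`) f)) ` {P. partition_on A P} = {P. partition_on (f ` A) P}"
    proof (intro equalityI subsetI)
      fix Q assume "Q \<in> {P. partition_on (f ` A) P}"
      then have Q: "partition_on (f ` A) Q" by simp
      let ?g = "inv_into A f"
      have P: "partition_on A ((`) ?g ` Q)"
        using image[OF Q inj_on_inv_into[OF order_refl]] assms by simp
      have "f ` ?g ` B = B" if "B \<in> Q" for B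
        using that Q by (intro image_inv_into_cancel[OF refl]) (auto simp: partition_on_def)
      then have "Q = (`) f ` (`) ?g ` Q"
        by (simp add: image_image)
      with P show "Q \<in> ((`) ((`) f)) ` {P. partition_on A P}"
        by blast
    qed (use image assms in auto)
  qed
  then show ?thesis
    by (simp add: bij_betw_same_card)
qed

section \<open>Diagrams and their number\<close>

lemma finite_vertices: "finite (vertices k)"
  by (simp add: vertices_def)

lemma finite_diagrams: "finite (diagrams k)"
  unfolding diagrams_def by (rule finitely_many_partition_on[OF finite_vertices])

lemma card_vertices: "card (vertices k) = 2 * k"
  by (simp add: vertices_def card_Plus)

lemma vertices_mono: "i \<le> j \<Longrightarrow> vertices i \<subseteq> vertices j"
  by (auto simp: vertices_def)

lemma card_diagrams: "card (diagrams k) = Bell (2 * k)"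
proof -
  obtain f where f: "bij_betw f {1..2 * k} (vertices k)"
    using finite_same_card_bij[of "{1..2 * k}" "vertices k"] finite_vertices card_vertices by auto
  then show ?thesis
    using card_partition_on_image[of f "{1..2 * k}"]
    by (simp add: bij_betw_def diagrams_def Bell_def)
qed

lemma diagrams_0: "diagrams 0 = {{}}"
  by (simp add: diagrams_def vertices_def Plus_def partition_on_empty)

lemma Union_diagram: "\<pi> \<in> diagrams k \<Longrightarrow> \<Union>\<pi> = vertices k"
  by (simp add: diagrams_def partition_on_def)

lemma empty_notin_diagram: "\<pi> \<in> diagrams k \<Longrightarrow> {} \<notin> \<pi>"
  by (simp add: diagrams_def partition_on_def)

lemma diagram_block_eq:
  assumes "\<pi> \<in> diagrams k" "B \<in> \<pi>" "C \<in> \<pi>" "x \<in> B" "x \<in> C"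
  shows "B = C"
  using assms by (auto simp: diagrams_def partition_on_def disjoint_def)

text \<open>A diagram is a bare set of blocks; its order is recovered from the size of its
  union.\<close>

lemma diagram_order_unique:
  assumes "\<pi> \<in> diagrams i" "\<pi> \<in> diagrams j"
  shows "i = j"
proof -
  have "vertices i = vertices j"
    using assms Union_diagram by metis
  then show ?thesis
    by (metis card_vertices mult_left_cancel zero_neq_numeral)
qed

section \<open>Left factors\<close>

lemma inj_shift: "inj (shift k)"
  by (rule injI) (auto simp: shift_def map_sum_def split: sum.splits)

lemma shift_image_vertices:
  assumes "i \<le> j"
  shows "shift i ` vertices (j - i) = vertices j - vertices i"
proof -
  have img: "(\<lambda>m. m + i) ` {1..j - i} = {i+1..j}"
    using assms by simp
  have "shift i ` vertices (j - i) = {i+1..j} <+> {i+1..j}"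
    unfolding img[symmetric] shift_def vertices_def Plus_def
    by (simp only: image_Un image_image map_sum.simps)
  also have "\<dots> = vertices j - vertices i"
    using assms by (auto simp: vertices_def)
  finally show ?thesis .
qed

lemma subset_tensor: "\<rho> \<subseteq> tensor i \<rho> \<sigma>"
  by (simp add: tensor_def)

text \<open>Converse of \<open>subset_tensor\<close>: the blocks outside \<rho> partition
  \<open>vertices j - vertices i\<close>, a shifted copy of \<open>vertices (j - i)\<close>, so
  undoing the shift gives \<sigma>.\<close>

lemma left_factor_of_subset:
  assumes "\<rho> \<in> diagrams i" "\<pi> \<in> diagrams j" "\<rho> \<subseteq> \<pi>"
  shows "i \<le> j" and "\<exists>\<sigma>\<in>diagrams (j - i). \<pi> = tensor i \<rho> \<sigma>"
proof -
  have "vertices i \<subseteq> vertices j"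
    using assms Union_diagram Union_mono by metis
  then have "card (vertices i) \<le> card (vertices j)"
    by (rule card_mono[OF finite_vertices])
  then show le: "i \<le> j"
    by (simp add: card_vertices)
  let ?g = "inv (shift i)"
  let ?\<sigma> = "(`) ?g ` (\<pi> - \<rho>)"
  have diff: "partition_on (shift i ` vertices (j - i)) (\<pi> - \<rho>)"
    using partition_on_Diff assms le by (simp add: diagrams_def shift_image_vertices)
  have inj: "inj_on ?g (shift i ` vertices (j - i))"
    by (intro inj_on_inv_into) auto
  have "{} \<notin> ?\<sigma>"
    using partition_onD3[OF diff] by auto
  with partition_on_inj_image[OF diff inj] have "?\<sigma> \<in> diagrams (j - i)"
    by (simp add: diagrams_def image_image inv_f_f[OF inj_shift])
  moreover have "shift i ` ?g ` B = B" if "B \<in> \<pi> - \<rho>" for B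
    using that partition_onD1[OF diff] by (intro image_inv_into_cancel[OF refl]) auto
  then have "(`) (shift i) ` ?\<sigma> = \<pi> - \<rho>"
    by (simp add: image_image)
  then have "\<pi> = tensor i \<rho> ?\<sigma>"
    using assms(3) by (auto simp: tensor_def)
  ultimately show "\<exists>\<sigma>\<in>diagrams (j - i). \<pi> = tensor i \<rho> \<sigma>"
    by blast
qed

text \<open>A point of a block of \<rho> lies in \<open>vertices j\<close>, hence in a block of
  \<rho>'. Both blocks belong to \<pi> and share this point, so they coincide.\<close>

lemma left_factors_chain:
  assumes "\<rho> \<in> diagrams i" "\<rho>' \<in> diagrams j" "\<pi> \<in> diagrams k"
    and "\<rho> \<subseteq> \<pi>" "\<rho>' \<subseteq> \<pi>" "i \<le> j"
  shows "\<rho> \<subseteq> \<rho>'"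
proof
  fix B assume B: "B \<in> \<rho>"
  then obtain x where x: "x \<in> B"
    using empty_notin_diagram[OF assms(1)] by fastforce
  then have "x \<in> \<Union>\<rho>'"
    using B Union_diagram[OF assms(1)] Union_diagram[OF assms(2)] vertices_mono[OF assms(6)]
    by blast
  then obtain C where "C \<in> \<rho>'" "x \<in> C" by blast
  moreover from this have "B = C"
    using diagram_block_eq[OF assms(3)] assms(4,5) B x by blast
  ultimately show "B \<in> \<rho>'" by simp
qed

section \<open>Irreducible left factors\<close>

text \<open>Otherwise the cofactor of \<rho> in \<rho>' has positive order \<open>j - i\<close>, and
  \<rho>' factors.\<close>

lemma tensor_irreducible_left_factor:
  assumes "tensor_irreducible \<rho>'" "\<rho> \<in> diagrams i" "\<rho>' \<in> diagrams j" "\<rho> \<subseteq> \<rho>'" "0 < i"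
  shows "i = j"
proof (rule ccontr)
  assume "i \<noteq> j"
  then have "0 < j - i"
    using left_factor_of_subset(1)[OF assms(2,3,4)] by simp
  then show False
    using left_factor_of_subset(2)[OF assms(2,3,4)] assms(1,2,5)
    unfolding tensor_irreducible_def by blast
qed

text \<open>By the chain property one factor contains the other, and irreducibility of the larger
  forces equal orders. The chain property then gives both inclusions.\<close>

lemma irreducible_left_factor_unique:
  assumes "\<rho> \<in> diagrams i" "\<rho>' \<in> diagrams j" "\<pi> \<in> diagrams k" "\<rho> \<subseteq> \<pi>" "\<rho>' \<subseteq> \<pi>"
    and "tensor_irreducible \<rho>" "tensor_irreducible \<rho>'" "0 < i" "0 < j"
  shows "i = j" "\<rho> = \<rho>'"
proof -
  show "i = j"
  proof (cases "i \<le> j")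
    case True
    then show ?thesis
      using tensor_irreducible_left_factor left_factors_chain assms by metis
  next
    case False
    then have "j \<le> i" by simp
    then show ?thesis
      using tensor_irreducible_left_factor left_factors_chain assms by metis
  qed
  then show "\<rho> = \<rho>'"
    using left_factors_chain assms by (metis order_refl subset_antisym)
qed

lemma irreducible_left_factor_exists:
  assumes "\<pi> \<in> diagrams k" "0 < k"
  obtains i \<rho> where "\<rho> \<in> diagrams i" "0 < i" "\<rho> \<subseteq> \<pi>" "tensor_irreducible \<rho>"
proof -
  let ?P = "\<lambda>i. 0 < i \<and> (\<exists>\<rho>\<in>diagrams i. \<rho> \<subseteq> \<pi>)"
  \<comment> \<open>The least positive order of a left factor; \<pi> itself is one, of order
    \<open>k\<close>.\<close>
  define i where "i = (LEAST i. ?P i)"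
  have "?P k"
    using assms by blast
  then have "?P i"
    unfolding i_def by (rule LeastI)
  then obtain \<rho> where \<rho>: "0 < i" "\<rho> \<in> diagrams i" "\<rho> \<subseteq> \<pi>" by blast
  have "tensor_irreducible \<rho>"
    unfolding tensor_irreducible_def
  proof clarify
    fix a b \<rho>1 \<rho>2
    assume ab: "\<rho>1 \<in> diagrams a" "\<rho>2 \<in> diagrams b" "0 < a" "0 < b" "\<rho> = tensor a \<rho>1 \<rho>2"
    have "i = a + b"
      using \<rho>(2) tensor_in_diagrams[OF ab(1,2)] ab(5) by (metis diagram_order_unique)
    \<comment> \<open>A left factor of \<rho> is one of \<pi>, here of order \<open>a < i\<close>,
      against minimality.\<close>
    moreover have "?P a"
      using ab \<rho>(3) subset_tensor by blast
    then have "i \<le> a"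
      unfolding i_def by (rule Least_le)
    ultimately show False
      using ab(4) by simp
  qed
  with \<rho> show thesis
    using that by blast
qed

section \<open>Recursion and generating functions\<close>

lemma tensor_inj_right:
  assumes "\<rho> \<in> diagrams i" "\<sigma> \<in> diagrams j" "\<sigma>' \<in> diagrams j" "tensor i \<rho> \<sigma> = tensor i \<rho> \<sigma>'"
  shows "\<sigma> = \<sigma>'"
proof -
  \<comment> \<open>Disjointness of the two families of blocks allows \<rho> to be cancelled from
    the unions.\<close>
  have disj: "\<rho> \<inter> (`) (shift i) ` \<tau> = {}" if \<tau>: "\<tau> \<in> diagrams j" for \<tau>
  proof -
    have False if "B \<in> \<tau>" "shift i ` B \<in> \<rho>" for B
    proof -
      have "B \<noteq> {}"
        using that empty_notin_diagram[OF \<tau>] by blast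
      moreover have "shift i ` B \<subseteq> vertices i" "shift i ` B \<subseteq> shift i ` vertices j"
        using that Union_diagram[OF assms(1)] Union_diagram[OF \<tau>] by auto
      ultimately show False
        using shift_image_vertices[of i "i + j"] by auto
    qed
    then show ?thesis by blast
  qed
  have "(`) (shift i) ` \<sigma> = (`) (shift i) ` \<sigma>'"
    using assms(4) disj[OF assms(2)] disj[OF assms(3)] unfolding tensor_def
    by (metis Un_Diff_cancel Diff_triv Un_Diff Diff_cancel sup_bot_left inf_commute)
  then show ?thesis
    by (simp add: inj_image_eq_iff inj_shift inj_on_image)
qed

text \<open>The coefficient form of \<open>F = 1 + I * F\<close>: each diagram corresponds to its
  irreducible left factor together with the cofactor.\<close>

lemma card_diagrams_rec:
  assumes "0 < k"
  shows "card (diagrams k) = (\<Sum>i=1..k. num_irreducible i * card (diagrams (k - i)))"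
proof -
  define I where "I i = {\<rho> \<in> diagrams i. tensor_irreducible \<rho>}" for i
  define S where "S = (SIGMA i:{1..k}. I i \<times> diagrams (k - i))"
  define f where "f = (\<lambda>(i, \<rho>, \<sigma>). tensor i \<rho> \<sigma>)"
  have mem: "tensor i \<rho> \<sigma> \<in> diagrams k"
    if "i \<le> k" "\<rho> \<in> I i" "\<sigma> \<in> diagrams (k - i)" for i \<rho> \<sigma>
    using tensor_in_diagrams[of \<rho> i \<sigma> "k - i"] that by (simp add: I_def)
  have "inj_on f S"
  proof (rule inj_onI)
    fix x y
    assume xy: "x \<in> S" "y \<in> S" "f x = f y"
    obtain i \<rho> \<sigma> j \<rho>' \<sigma>' where x: "x = (i, \<rho>, \<sigma>)" and y: "y = (j, \<rho>', \<sigma>')"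
      by (cases x, cases y)
    note S = xy(1,2)[unfolded x y]
    have eq: "tensor i \<rho> \<sigma> = tensor j \<rho>' \<sigma>'"
      using xy(3) by (simp add: f_def x y)
    have sub: "\<rho> \<subseteq> tensor i \<rho> \<sigma>" "\<rho>' \<subseteq> tensor i \<rho> \<sigma>"
      unfolding eq by (simp_all add: subset_tensor) (simp add: eq[symmetric] subset_tensor)
    have \<rho>: "\<rho> \<in> diagrams i" "\<rho>' \<in> diagrams j" "tensor i \<rho> \<sigma> \<in> diagrams k"
      "tensor_irreducible \<rho>" "tensor_irreducible \<rho>'" "0 < i" "0 < j"
      using S mem by (auto simp: S_def I_def)
    note uniq = irreducible_left_factor_unique[OF \<rho>(1,2,3) sub \<rho>(4-7)]
    moreover have "\<sigma> = \<sigma>'"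
      using tensor_inj_right[OF \<rho>(1), of \<sigma> "k - i" \<sigma>'] S eq uniq by (simp add: S_def)
    ultimately show "x = y"
      by (simp add: x y)
  qed
  moreover have "f ` S = diagrams k"
  proof (intro equalityI subsetI)
    fix \<pi> assume \<pi>: "\<pi> \<in> diagrams k"
    then obtain i \<rho> where \<rho>: "\<rho> \<in> diagrams i" "0 < i" "\<rho> \<subseteq> \<pi>" "tensor_irreducible \<rho>"
      using irreducible_left_factor_exists[OF \<pi> assms] by blast
    obtain \<sigma> where "\<sigma> \<in> diagrams (k - i)" "\<pi> = tensor i \<rho> \<sigma>"
      using left_factor_of_subset(2)[OF \<rho>(1) \<pi> \<rho>(3)] by blast
    moreover have "i \<le> k"
      using left_factor_of_subset(1)[OF \<rho>(1) \<pi> \<rho>(3)] .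
    ultimately have "(i, \<rho>, \<sigma>) \<in> S" "\<pi> = f (i, \<rho>, \<sigma>)"
      using \<rho> by (auto simp: S_def I_def f_def)
    then show "\<pi> \<in> f ` S" by blast
  qed (use mem in \<open>auto simp: S_def f_def\<close>)
  ultimately have "card (diagrams k) = card S"
    by (metis card_image)
  also have "\<dots> = (\<Sum>i=1..k. card (I i \<times> diagrams (k - i)))"
    unfolding S_def by (rule card_SigmaI) (auto simp: I_def finite_diagrams)
  also have "\<dots> = (\<Sum>i=1..k. num_irreducible i * card (diagrams (k - i)))"
    by (simp add: card_cartesian_product num_irreducible_def I_def)
  finally show ?thesis .
qed

theorem theorem2p9:
  "Abs_fps (\<lambda>k. if k \<ge> 1 then of_nat (num_irreducible k) else 0)
     = (1 - 1 / (1 + Abs_fps (\<lambda>k. if k \<ge> 1 then of_nat (Bell (2 * k)) else 0)) :: rat fps)"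
proof -
  define F :: "rat fps" where "F = Abs_fps (\<lambda>k. of_nat (card (diagrams k)))"
  define I :: "rat fps" where "I = Abs_fps (\<lambda>k. if k \<ge> 1 then of_nat (num_irreducible k) else 0)"
  have F_eq: "1 + Abs_fps (\<lambda>k. if k \<ge> 1 then of_nat (Bell (2 * k)) else 0) = F"
    \<comment> \<open>The single diagram of order 0 supplies the constant term 1.\<close>
    by (rule fps_ext) (auto simp: F_def card_diagrams[symmetric] diagrams_0 not_le)
  have "F = 1 + I * F"
  proof (rule fps_ext)
    fix k
    show "fps_nth F k = fps_nth (1 + I * F) k"
    proof (cases "k = 0")
      case True
      then show ?thesis by (simp add: F_def I_def diagrams_0)
    next
      case False
      have "fps_nth (I * F) k = (\<Sum>i=0..k. fps_nth I i * fps_nth F (k - i))"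
        by (rule fps_mult_nth)
      \<comment> \<open>The term at 0 vanishes because \<open>I\<close> has constant coefficient
        0.\<close>
      also have "\<dots> = (\<Sum>i=1..k. fps_nth I i * fps_nth F (k - i))"
        by (rule sum.mono_neutral_right) (auto simp: I_def)
      also have "\<dots> = of_nat (\<Sum>i=1..k. num_irreducible i * card (diagrams (k - i)))"
        by (simp add: I_def F_def)
      also have "\<dots> = fps_nth F k"
        using False by (simp add: F_def card_diagrams_rec)
      finally show ?thesis
        using False by simp
    qed
  qed
  then have "(1 - I) * F = 1"
    by (simp add: algebra_simps)
  \<comment> \<open>This makes \<open>F\<close> a unit, so that \<open>1 / F\<close> is its
    inverse.\<close>
  moreover have "fps_nth F 0 \<noteq> 0"
    by (simp add: F_def diagrams_0)
  ultimately have "1 / F = 1 - I"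
    by (metis fps_divide_unit fps_inverse_unique inverse_mult_eq_1 mult.commute mult_1)
  then show ?thesis
    unfolding F_eq I_def[symmetric] by simp
qed

end
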